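(* Let $M$ be a submanifold of an almost contact metric manifold $N=(N,\phi,\xi,\eta,g)$. Then $M$ is a pointwise slant submanifold of $N$ if and only if $T^2=-\cos^2\theta\cdot I$ on $T^1M$ for some function $\theta:M\to\mathbb{R}$.
   Context: An almost contact metric manifold $(N,\phi,\xi,\eta,g)$ is a smooth manifold $N$ of dimension $2n+1$ with a tensor field $\phi$ of type $(1,1)$, a vector field $\xi$, a $1$-form $\eta$ and a Riemannian metric $g$ such that $\phi^2=-I+\eta\otimes\xi$, $\eta(\xi)=1$ and $g(\phi X,\phi Y)=g(X,Y)-\eta(X)\eta(Y)$ for all vector fields $X,Y$ (hence $\phi\xi=0$, $\eta\circ\phi=0$, $\eta(X)=g(X,\xi)$). For a submanifold $M$ of $N$ and $p\in M$ put $M_p:=\{X\in T_pM\mid g(X,\xi(p))=0\}$ and $T^1M:=\bigcup_{p\in M}M_p$. $M$ is called a pointwise slant submanifold if at each given point $p\in M$ the angle $\theta=\theta(X)$ between $\phi X$ and the space $M_p$ is constant for nonzero $X\in M_p$; the resulting function $\theta$ on $M$ is called the slant function. For $X$ tangent to $M$ write $\phi X=TX+FX$, with $TX$ tangent to $M$ and $FX$ normal to $M$. $I$ denotes the identity.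
   Formalization: The formal statement additionally assumes that T maps each M_p into itself (automatic if ξ is tangent or normal to M at each point); without this the equivalence fails, e.g. for M = span(e1, e2, e3+e5) in flat R^5 with ξ = e5, φe1 = e3, φe2 = e4. *)

theory Defs
  imports "HOL-Analysis.Analysis" "HOL-Library.Function_Algebras"
begin

section \<open>Smooth maps between open subsets of Euclidean spaces\<close>

text \<open>Meant for open \<open>S\<close>: the directional derivatives of a \<open>C\<close>-(\<open>k+1\<close>) map are required to be \<open>C\<close>-\<open>k\<close>.\<close>

fun Ck_on :: "nat \<Rightarrow> 'e::euclidean_space set \<Rightarrow> ('e \<Rightarrow> 'b::real_normed_vector) \<Rightarrow> bool" where
  "Ck_on 0 S f \<longleftrightarrow> continuous_on S f"
| "Ck_on (Suc k) S f \<longleftrightarrow>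
     (\<forall>x\<in>S. f differentiable (at x)) \<and> (\<forall>v. Ck_on k S (\<lambda>x. frechet_derivative f (at x) v))"

definition smooth_on :: "'e::euclidean_space set \<Rightarrow> ('e \<Rightarrow> 'b::real_normed_vector) \<Rightarrow> bool" where
  "smooth_on S f \<longleftrightarrow> (\<forall>k. Ck_on k S f)"


section \<open>Smooth manifolds\<close>

text \<open>A chart is a pair of its domain and its coordinate map; values of the coordinate map outside
  the domain are irrelevant. The model space is the Euclidean space \<open>'e\<close>, so a manifold has
  dimension \<open>DIM('e)\<close>.\<close>

type_synonym ('a, 'e) chart = "'a set \<times> ('a \<Rightarrow> 'e)"

definition chart_image :: "('a, 'e) chart \<Rightarrow> 'e set" where
  "chart_image c = snd c ` fst c"

definition chart_inv :: "('a, 'e) chart \<Rightarrow> 'e \<Rightarrow> 'a" where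
  "chart_inv c = inv_into (fst c) (snd c)"

definition charts_at :: "('a, 'e) chart set \<Rightarrow> 'a \<Rightarrow> ('a, 'e) chart set" where
  "charts_at A p = {c \<in> A. p \<in> fst c}"

definition transition :: "('a, 'e) chart \<Rightarrow> ('a, 'f) chart \<Rightarrow> 'e \<Rightarrow> 'f" where
  "transition c d = snd d \<circ> chart_inv c"

locale smooth_manifold =
  fixes X :: "'a topology" and A :: "('a, 'e::euclidean_space) chart set"
  assumes Hausdorff: "Hausdorff_space X"
    and second_countable: "second_countable X"
    and covers: "(\<Union>c\<in>A. fst c) = topspace X"
    and chart_open: "c \<in> A \<Longrightarrow> openin X (fst c) \<and> open (chart_image c)"
    and chart_homeo: "c \<in> A \<Longrightarrow>
      homeomorphic_map (subtopology X (fst c)) (top_of_set (chart_image c)) (snd c)"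
    and compatible: "c \<in> A \<Longrightarrow> d \<in> A \<Longrightarrow> smooth_on (snd c ` (fst c \<inter> fst d)) (transition c d)"


section \<open>Tangent spaces and tensor fields\<close>

instantiation "fun" :: (type, real_vector) real_vector
begin

definition scaleR_fun :: "real \<Rightarrow> ('a \<Rightarrow> 'b) \<Rightarrow> 'a \<Rightarrow> 'b" where
  "scaleR_fun r f = (\<lambda>x. r *\<^sub>R f x)"

instance
  by standard (simp_all add: scaleR_fun_def plus_fun_def fun_eq_iff scaleR_add_right scaleR_add_left)

end

text \<open>A tangent vector at \<open>p\<close> is given by its components in all charts around \<open>p\<close>, which are
  related by the derivatives of the coordinate changes. The components are set to 0 for all pairs
  that are not charts around \<open>p\<close>, so that equality of tangent vectors is equality of functions,
  and the vector space operations are pointwise.\<close>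

type_synonym ('a, 'e) tvec = "('a, 'e) chart \<Rightarrow> 'e"

definition tangent_space :: "('a, 'e::euclidean_space) chart set \<Rightarrow> 'a \<Rightarrow> ('a, 'e) tvec set" where
  "tangent_space A p = {v.
     (\<forall>c\<in>charts_at A p. \<forall>d\<in>charts_at A p.
        v d = frechet_derivative (transition c d) (at (snd c p)) (v c)) \<and>
     (\<forall>c. c \<notin> charts_at A p \<longrightarrow> v c = 0)}"

text \<open>The tangent vector at \<open>p\<close> whose component in the chart \<open>c\<close> is \<open>x\<close>: for constant \<open>x\<close> these
  are the constant-coefficient combinations of the coordinate vector fields of \<open>c\<close>.\<close>

definition coord_vec ::
  "('a, 'e::euclidean_space) chart set \<Rightarrow> ('a, 'e) chart \<Rightarrow> 'a \<Rightarrow> 'e \<Rightarrow> ('a, 'e) tvec" where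
  "coord_vec A c p x =
     (\<lambda>d. if d \<in> charts_at A p then frechet_derivative (transition c d) (at (snd c p)) x else 0)"

definition linear_between :: "'v::real_vector set \<Rightarrow> 'w::real_vector set \<Rightarrow> ('v \<Rightarrow> 'w) \<Rightarrow> bool" where
  "linear_between V W f \<longleftrightarrow> f ` V \<subseteq> W \<and>
     (\<forall>u\<in>V. \<forall>v\<in>V. f (u + v) = f u + f v) \<and> (\<forall>r. \<forall>v\<in>V. f (r *\<^sub>R v) = r *\<^sub>R f v)"

definition smooth_vector_field ::
  "('a, 'e::euclidean_space) chart set \<Rightarrow> 'a set \<Rightarrow> ('a \<Rightarrow> ('a, 'e) tvec) \<Rightarrow> bool" where
  "smooth_vector_field A N \<xi> \<longleftrightarrow>
     (\<forall>p\<in>N. \<xi> p \<in> tangent_space A p) \<and>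
     (\<forall>c\<in>A. smooth_on (chart_image c) (\<lambda>y. \<xi> (chart_inv c y) c))"

definition smooth_one_form ::
  "('a, 'e::euclidean_space) chart set \<Rightarrow> 'a set \<Rightarrow> ('a \<Rightarrow> ('a, 'e) tvec \<Rightarrow> real) \<Rightarrow> bool" where
  "smooth_one_form A N \<eta> \<longleftrightarrow>
     (\<forall>p\<in>N. linear_between (tangent_space A p) UNIV (\<eta> p)) \<and>
     (\<forall>c\<in>A. \<forall>x. smooth_on (chart_image c)
        (\<lambda>y. \<eta> (chart_inv c y) (coord_vec A c (chart_inv c y) x)))"

definition smooth_tensor_1_1 ::
  "('a, 'e::euclidean_space) chart set \<Rightarrow> 'a set \<Rightarrow> ('a \<Rightarrow> ('a, 'e) tvec \<Rightarrow> ('a, 'e) tvec) \<Rightarrow> bool"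
  where
  "smooth_tensor_1_1 A N \<phi> \<longleftrightarrow>
     (\<forall>p\<in>N. linear_between (tangent_space A p) (tangent_space A p) (\<phi> p)) \<and>
     (\<forall>c\<in>A. \<forall>x. smooth_on (chart_image c)
        (\<lambda>y. \<phi> (chart_inv c y) (coord_vec A c (chart_inv c y) x) c))"

definition riemannian_metric ::
  "('a, 'e::euclidean_space) chart set \<Rightarrow> 'a set \<Rightarrow>
   ('a \<Rightarrow> ('a, 'e) tvec \<Rightarrow> ('a, 'e) tvec \<Rightarrow> real) \<Rightarrow> bool" where
  "riemannian_metric A N g \<longleftrightarrow>
     (\<forall>p\<in>N. \<forall>u\<in>tangent_space A p. linear_between (tangent_space A p) UNIV (g p u)) \<and>
     (\<forall>p\<in>N. \<forall>u\<in>tangent_space A p. \<forall>v\<in>tangent_space A p. g p u v = g p v u) \<and>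
     (\<forall>p\<in>N. \<forall>u\<in>tangent_space A p. u \<noteq> 0 \<longrightarrow> g p u u > 0) \<and>
     (\<forall>c\<in>A. \<forall>x x'. smooth_on (chart_image c)
        (\<lambda>y. g (chart_inv c y) (coord_vec A c (chart_inv c y) x) (coord_vec A c (chart_inv c y) x')))"


section \<open>Almost contact metric manifolds\<close>

locale almost_contact_metric_manifold = smooth_manifold X A
  for X :: "'a topology" and A :: "('a, 'e::euclidean_space) chart set" +
  fixes n :: nat
    and \<phi> :: "'a \<Rightarrow> ('a, 'e) tvec \<Rightarrow> ('a, 'e) tvec"
    and \<xi> :: "'a \<Rightarrow> ('a, 'e) tvec"
    and \<eta> :: "'a \<Rightarrow> ('a, 'e) tvec \<Rightarrow> real"
    and g :: "'a \<Rightarrow> ('a, 'e) tvec \<Rightarrow> ('a, 'e) tvec \<Rightarrow> real"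
  assumes dimension: "DIM('e) = 2 * n + 1"
    and phi_tensor: "smooth_tensor_1_1 A (topspace X) \<phi>"
    and xi_field: "smooth_vector_field A (topspace X) \<xi>"
    and eta_form: "smooth_one_form A (topspace X) \<eta>"
    and metric: "riemannian_metric A (topspace X) g"
    and phi_phi: "p \<in> topspace X \<Longrightarrow> u \<in> tangent_space A p \<Longrightarrow>
      \<phi> p (\<phi> p u) = - u + \<eta> p u *\<^sub>R \<xi> p"
    and eta_xi: "p \<in> topspace X \<Longrightarrow> \<eta> p (\<xi> p) = 1"
    and metric_phi: "p \<in> topspace X \<Longrightarrow> u \<in> tangent_space A p \<Longrightarrow> v \<in> tangent_space A p \<Longrightarrow>
      g p (\<phi> p u) (\<phi> p v) = g p u v - \<eta> p u * \<eta> p v"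


section \<open>Submanifolds\<close>

text \<open>A submanifold of \<open>X\<close> is a manifold \<open>Y\<close>, with its own topology, whose points are points of
  \<open>X\<close> and for which the inclusion is a smooth immersion. Embedded submanifolds are those for which
  in addition \<open>Y\<close> carries the subspace topology. In charts \<open>b\<close> of \<open>Y\<close> and \<open>c\<close> of \<open>X\<close> the
  inclusion is \<open>transition b c\<close>.\<close>

locale submanifold = M: smooth_manifold Y B + N: smooth_manifold X A
  for Y :: "'a topology" and B :: "('a, 'f::euclidean_space) chart set"
    and X :: "'a topology" and A :: "('a, 'e::euclidean_space) chart set" +
  assumes subset: "topspace Y \<subseteq> topspace X"
    and inclusion_continuous: "continuous_map Y X id"
    and inclusion_smooth: "b \<in> B \<Longrightarrow> c \<in> A \<Longrightarrow>
      smooth_on (snd b ` (fst b \<inter> fst c)) (transition b c)"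
    and inclusion_immersion: "b \<in> charts_at B p \<Longrightarrow> c \<in> charts_at A p \<Longrightarrow>
      inj (frechet_derivative (transition b c) (at (snd b p)))"

text \<open>The tangent space of the submanifold at \<open>p\<close>, as a subspace of the tangent space of the
  ambient manifold: the image of the differential of the inclusion.\<close>

definition sub_tangent_space ::
  "('a, 'f::euclidean_space) chart set \<Rightarrow> ('a, 'e::euclidean_space) chart set \<Rightarrow> 'a \<Rightarrow>
   ('a, 'e) tvec set" where
  "sub_tangent_space B A p = {v \<in> tangent_space A p. \<exists>w\<in>tangent_space B p.
     \<forall>b\<in>charts_at B p. \<forall>c\<in>charts_at A p.
       v c = frechet_derivative (transition b c) (at (snd b p)) (w b)}"


section \<open>Pointwise slant submanifolds\<close>

definition orth_proj :: "('v::real_vector \<Rightarrow> 'v \<Rightarrow> real) \<Rightarrow> 'v set \<Rightarrow> 'v \<Rightarrow> 'v" where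
  "orth_proj h W v = (THE w. w \<in> W \<and> (\<forall>z\<in>W. h (v - w) z = 0))"

text \<open>The angle in \<open>[0, \<pi>/2]\<close> between a nonzero vector and a subspace, with respect to the inner
  product \<open>h\<close>. It is \<open>\<pi>/2\<close> if the vector is orthogonal to the subspace.\<close>

definition angle_to_subspace :: "('v::real_vector \<Rightarrow> 'v \<Rightarrow> real) \<Rightarrow> 'v set \<Rightarrow> 'v \<Rightarrow> real" where
  "angle_to_subspace h W v =
     arccos (sqrt (h (orth_proj h W v) (orth_proj h W v)) / sqrt (h v v))"

text \<open>The space \<open>M\<^sub>p\<close>.\<close>

definition xi_orth_space ::
  "('a, 'f::euclidean_space) chart set \<Rightarrow> ('a, 'e::euclidean_space) chart set \<Rightarrow>
   ('a \<Rightarrow> ('a, 'e) tvec) \<Rightarrow> ('a \<Rightarrow> ('a, 'e) tvec \<Rightarrow> ('a, 'e) tvec \<Rightarrow> real) \<Rightarrow> 'a \<Rightarrow>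
   ('a, 'e) tvec set" where
  "xi_orth_space B A \<xi> g p = {v \<in> sub_tangent_space B A p. g p v (\<xi> p) = 0}"

definition pointwise_slant ::
  "'a topology \<Rightarrow> ('a, 'f::euclidean_space) chart set \<Rightarrow> ('a, 'e::euclidean_space) chart set \<Rightarrow>
   ('a \<Rightarrow> ('a, 'e) tvec \<Rightarrow> ('a, 'e) tvec) \<Rightarrow> ('a \<Rightarrow> ('a, 'e) tvec) \<Rightarrow>
   ('a \<Rightarrow> ('a, 'e) tvec \<Rightarrow> ('a, 'e) tvec \<Rightarrow> real) \<Rightarrow> bool" where
  "pointwise_slant Y B A \<phi> \<xi> g \<longleftrightarrow>
     (\<forall>p\<in>topspace Y. \<exists>t. \<forall>v\<in>xi_orth_space B A \<xi> g p. v \<noteq> 0 \<longrightarrow>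
        angle_to_subspace (g p) (xi_orth_space B A \<xi> g p) (\<phi> p v) = t)"

text \<open>\<open>T v\<close> is the tangential component of \<open>\<phi> v\<close> in the decomposition \<open>\<phi> v = T v + F v\<close> into a
  vector tangent and a vector normal to the submanifold.\<close>

definition tangential_part ::
  "('a, 'f::euclidean_space) chart set \<Rightarrow> ('a, 'e::euclidean_space) chart set \<Rightarrow>
   ('a \<Rightarrow> ('a, 'e) tvec \<Rightarrow> ('a, 'e) tvec) \<Rightarrow>
   ('a \<Rightarrow> ('a, 'e) tvec \<Rightarrow> ('a, 'e) tvec \<Rightarrow> real) \<Rightarrow> 'a \<Rightarrow> ('a, 'e) tvec \<Rightarrow> ('a, 'e) tvec" where
  "tangential_part B A \<phi> g p v = orth_proj (g p) (sub_tangent_space B A p) (\<phi> p v)"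

end

theory Submission
  imports Defs
begin

text \<open>Everything happens in a single tangent space. On \<open>M\<^sub>p\<close> the map \<open>\<phi>\<close> is isometric and
  skew-symmetric, hence its compression \<open>T\<close> is skew-symmetric. As \<open>T\<close> preserves \<open>M\<^sub>p\<close>, the vector
  \<open>T v\<close> is also the projection of \<open>\<phi> v\<close> to \<open>M\<^sub>p\<close>, so the cosine of the angle between them is
  \<open>\<bar>T v\<bar> / \<bar>v\<bar>\<close>. It is constantly \<open>cos t\<close> iff \<open>\<langle>T v, T v\<rangle> = cos\<^sup>2 t \<langle>v, v\<rangle>\<close> for all \<open>v\<close> in \<open>M\<^sub>p\<close>,
  which by polarization and skew-symmetry means \<open>T\<^sup>2 = - cos\<^sup>2 t\<close> there.\<close>

section \<open>Orthogonal projections\<close>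

text \<open>Stated relative to a carrier \<open>V\<close>, because tangent spaces are mere subsets
  of the function space \<open>tvec\<close> and the metric is controlled only on them.\<close>

locale inner_product_on =
  fixes V :: "'v::real_vector set" and h :: "'v \<Rightarrow> 'v \<Rightarrow> real"
  assumes subspace: "subspace V"
    and linear_right: "u \<in> V \<Longrightarrow> linear_between V UNIV (h u)"
    and sym: "u \<in> V \<Longrightarrow> v \<in> V \<Longrightarrow> h u v = h v u"
    and pos: "u \<in> V \<Longrightarrow> u \<noteq> 0 \<Longrightarrow> h u u > 0"
begin

lemmas closed [simp, intro] =
  subspace_0[OF subspace] subspace_add[OF subspace] subspace_diff[OF subspace]
  subspace_neg[OF subspace] subspace_scale[OF subspace]

lemma add_right: "u \<in> V \<Longrightarrow> v \<in> V \<Longrightarrow> w \<in> V \<Longrightarrow> h u (v + w) = h u v + h u w"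
  and scale_right: "u \<in> V \<Longrightarrow> v \<in> V \<Longrightarrow> h u (r *\<^sub>R v) = r * h u v"
  using linear_right[of u] by (auto simp: linear_between_def)

lemma add_left: "u \<in> V \<Longrightarrow> v \<in> V \<Longrightarrow> w \<in> V \<Longrightarrow> h (v + w) u = h v u + h w u"
  by (simp add: sym[of _ u] add_right)

lemma scale_left: "u \<in> V \<Longrightarrow> v \<in> V \<Longrightarrow> h (r *\<^sub>R v) u = r * h v u"
  by (simp add: sym[of _ u] scale_right)

lemma minus_right: "u \<in> V \<Longrightarrow> v \<in> V \<Longrightarrow> h u (- v) = - h u v"
  using scale_right[of u v "-1"] by simp

lemma diff_right: "u \<in> V \<Longrightarrow> v \<in> V \<Longrightarrow> w \<in> V \<Longrightarrow> h u (v - w) = h u v - h u w"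
  using add_right[of u v "- w"] by (simp add: minus_right)

lemma diff_left: "u \<in> V \<Longrightarrow> v \<in> V \<Longrightarrow> w \<in> V \<Longrightarrow> h (v - w) u = h v u - h w u"
  by (simp add: sym[of _ u] diff_right)

lemma zero_right [simp]: "u \<in> V \<Longrightarrow> h u 0 = 0"
  using scale_right[of u 0 0] by simp

lemma zero_left [simp]: "u \<in> V \<Longrightarrow> h 0 u = 0"
  using scale_left[of u 0 0] by simp

lemma self_nonneg: "u \<in> V \<Longrightarrow> h u u \<ge> 0"
  using pos[of u] by (cases "u = 0") auto

lemma self_eq_0_iff: "u \<in> V \<Longrightarrow> h u u = 0 \<longleftrightarrow> u = 0"
  using pos[of u] by (cases "u = 0") auto

text \<open>Two candidates differ by a vector of \<open>W\<close> that is orthogonal to itself, so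
  any witness is the value of the description.\<close>

lemma orth_proj_eqI:
  assumes "subspace W" "W \<subseteq> V" "v \<in> V" "w \<in> W" "\<forall>z\<in>W. h (v - w) z = 0"
  shows "orth_proj h W v = w"
  unfolding orth_proj_def
proof (rule the_equality)
  show "w \<in> W \<and> (\<forall>z\<in>W. h (v - w) z = 0)"
    using assms by blast
next
  fix w' assume w': "w' \<in> W \<and> (\<forall>z\<in>W. h (v - w') z = 0)"
  then have d: "w' - w \<in> W" "w' \<in> V" "w \<in> V"
    using assms subspace_diff by blast+
  have "h (w' - w) (w' - w) = h (v - w) (w' - w) - h (v - w') (w' - w)"
    using d assms(3) by (simp add: diff_left diff_right)
  also have "\<dots> = 0"
    using d w' assms(5) by simp
  finally show "w' = w"
    using self_eq_0_iff[of "w' - w"] d by simp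
qed

text \<open>Gram-Schmidt, one generator at a time. The claim stays general in \<open>v\<close> since
  the induction step projects both \<open>v\<close> and the new generator \<open>a\<close>.\<close>

lemma orthogonal_decomposition_span:
  assumes "finite S" "S \<subseteq> V" "v \<in> V"
  shows "\<exists>w\<in>span S. \<forall>z\<in>span S. h (v - w) z = 0"
  using assms
proof (induction S arbitrary: v rule: finite_induct)
  case empty
  then show ?case by simp
next
  case (insert a S)
  have SV: "span S \<subseteq> V"
    using insert.prems subspace by (simp add: span_minimal)
  have aV: "a \<in> V" using insert.prems by simp
  obtain a0 where a0: "a0 \<in> span S" "\<forall>z\<in>span S. h (a - a0) z = 0"
    using insert.IH[of a] insert.prems by auto
  obtain v0 where v0: "v0 \<in> span S" "\<forall>z\<in>span S. h (v - v0) z = 0"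
    using insert.IH[of v] insert.prems by auto
  have V0: "a0 \<in> V" "v0 \<in> V" using a0 v0 SV by auto
  define e where "e = a - a0"
  define r where "r = h (v - v0) e / h e e"
  have e: "e \<in> V" using V0 aV by (simp add: e_def)
  \<comment> \<open>If \<open>e = 0\<close>, division by zero makes \<open>r = 0\<close> and the
    identity persists, so \<open>a\<close> may already lie in \<open>span S\<close>.\<close>
  have r: "h (v - v0) e = r * h e e"
    using self_eq_0_iff[OF e] insert.prems V0 by (cases "e = 0") (auto simp: r_def)
  have sub: "span S \<subseteq> span (insert a S)" by (rule span_mono) auto
  have "v0 + r *\<^sub>R e \<in> span (insert a S)"
    unfolding e_def using sub a0 v0
    by (intro span_add span_scale span_diff) (auto intro: span_base)
  moreover have "h (v - (v0 + r *\<^sub>R e)) z = 0" if z_in: "z \<in> span (insert a S)" for z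
  proof -
    obtain k where k: "z - k *\<^sub>R a \<in> span S"
      using z_in by (auto simp: span_insert)
    \<comment> \<open>Substituting \<open>a = a0 + e\<close> splits \<open>z\<close> into a vector
      of \<open>span S\<close> and a multiple of \<open>e\<close>; the mixed products vanish and
      \<open>r\<close> cancels the rest.\<close>
    define y where "y = (z - k *\<^sub>R a) + k *\<^sub>R a0"
    have y: "y \<in> span S" "y \<in> V"
      using k a0 SV by (auto simp: y_def intro!: span_add span_scale)
    have z: "z = y + k *\<^sub>R e" by (simp add: y_def e_def algebra_simps)
    have "h (v - v0) y = 0" "h e y = 0"
      using v0 a0 y by (auto simp: e_def)
    then have "h ((v - v0) - r *\<^sub>R e) z = 0"
      unfolding z using insert.prems V0 e y r
      by (simp only: diff_left add_right scale_left scale_right closed insert_subset) simp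
    then show ?thesis by (simp add: algebra_simps)
  qed
  ultimately show ?case by blast
qed

section \<open>Compression of a skew isometry to a subspace\<close>

text \<open>The roles are: \<open>V\<close> the ambient tangent space, \<open>W\<close> that of the
  submanifold, \<open>D\<close> the space \<open>M\<^sub>p\<close>, and \<open>J\<close> the map
  \<phi>. Existence of projections enters as \<open>ex\<close>, since \<open>V\<close> may have
  infinite dimension here.\<close>

lemma compression_slant_iff:
  fixes J T :: "'v \<Rightarrow> 'v"
  assumes D: "subspace D" "D \<subseteq> W" and W: "subspace W" "W \<subseteq> V"
    and ex: "\<And>v. v \<in> V \<Longrightarrow> \<exists>w\<in>W. \<forall>z\<in>W. h (v - w) z = 0"
    and J: "linear_between V V J"
    and iso: "\<And>v. v \<in> D \<Longrightarrow> h (J v) (J v) = h v v"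
    and skew: "\<And>u v. u \<in> D \<Longrightarrow> v \<in> D \<Longrightarrow> h (J u) v = - h u (J v)"
    and T: "\<And>v. T v = orth_proj h W (J v)"
    and TD: "\<And>v. v \<in> D \<Longrightarrow> T v \<in> D"
  shows "(\<exists>t. \<forall>v\<in>D. v \<noteq> 0 \<longrightarrow> angle_to_subspace h D (J v) = t) \<longleftrightarrow>
    (\<exists>t. \<forall>v\<in>D. T (T v) = - ((cos t)\<^sup>2 *\<^sub>R v))"
proof -
  have DV: "v \<in> V" if "v \<in> D" for v using that D W by blast
  have JV: "J v \<in> V" if "v \<in> D" for v
    using DV[OF that] J by (auto simp: linear_between_def)
  \<comment> \<open>The description in \<open>orth_proj\<close> says something only once a
    projection exists; \<open>ex\<close> supplies it.\<close>
  have T_orth: "h (J v - T v) z = 0" if "v \<in> D" "z \<in> W" for v z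
  proof -
    obtain w where w: "w \<in> W" "\<forall>z\<in>W. h (J v - w) z = 0"
      using ex[OF JV[OF \<open>v \<in> D\<close>]] by blast
    moreover have "T v = w"
      unfolding T using W JV[OF that(1)] w by (rule orth_proj_eqI)
    ultimately show ?thesis using that by blast
  qed
  \<comment> \<open>\<open>J u - T u\<close> is orthogonal to \<open>W\<close>, hence to
    \<open>D\<close>.\<close>
  have hT: "h (T u) v = h (J u) v" if "u \<in> D" "v \<in> D" for u v
    using T_orth[of u v] that D DV JV TD by (auto simp: diff_left)
  have T_skew: "h (T u) v = - h u (T v)" if "u \<in> D" "v \<in> D" for u v
    using hT[OF that] hT[of v u] skew[OF that] that DV JV TD by (simp add: sym[of u])
  \<comment> \<open>Additivity comes from skew-symmetry: in \<open>h x x\<close> for the defect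
    \<open>x\<close>, moving \<open>T\<close> onto \<open>x\<close> leaves terms additive in
    \<open>u\<close> and \<open>v\<close>, which cancel.\<close>
  have T_add: "T (u + v) = T u + T v" if uv: "u \<in> D" "v \<in> D" for u v
  proof -
    have s: "u + v \<in> D" "T (u + v) \<in> D" "T u \<in> D" "T v \<in> D"
      using uv TD subspace_add[OF D(1)] by auto
    define x where "x = T (u + v) - (T u + T v)"
    have x: "x \<in> D" unfolding x_def using s D(1) subspace_add subspace_diff by blast
    have "h x x = h (T (u + v)) x - (h (T u) x + h (T v) x)"
      using s x DV by (subst (1) x_def) (simp add: diff_left add_left)
    also have "\<dots> = 0"
      using uv s x TD[OF x] DV by (simp add: T_skew add_left)
    finally show ?thesis
      using self_eq_0_iff[of x] x DV by (simp add: x_def)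
  qed
  have proj: "orth_proj h D (J v) = T v" if "v \<in> D" for v
    using that D W JV TD T_orth by (intro orth_proj_eqI) auto
  have angle: "angle_to_subspace h D (J v) = arccos (sqrt (h (T v) (T v)) / sqrt (h v v))"
    if "v \<in> D" for v
    using that by (simp add: angle_to_subspace_def proj iso)
  \<comment> \<open>Pythagoras. It keeps the quotient in the angle at most 1, so that
    \<open>cos\<close> undoes \<open>arccos\<close>.\<close>
  have T_le: "h (T v) (T v) \<le> h v v" if "v \<in> D" for v
  proof -
    have V: "T v \<in> V" "J v \<in> V" using that TD DV JV by auto
    have "h (J v - T v) (J v - T v) = h (J v) (J v) - h (T v) (T v)"
      using hT[of v "T v"] that TD V by (simp add: diff_left diff_right sym[of "T v" "J v"])
    then show ?thesis
      using self_nonneg[of "J v - T v"] V iso[OF that] by simp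
  qed
  show ?thesis
  proof
    assume "\<exists>t. \<forall>v\<in>D. v \<noteq> 0 \<longrightarrow> angle_to_subspace h D (J v) = t"
    then obtain t where t: "\<And>v. v \<in> D \<Longrightarrow> v \<noteq> 0 \<Longrightarrow> angle_to_subspace h D (J v) = t"
      by blast
    have norm_T: "h (T v) (T v) = (cos t)\<^sup>2 * h v v" if v: "v \<in> D" for v
    \<comment> \<open>The angle hypothesis is silent about the zero vector; there skew-symmetry
      gives the identity.\<close>
    proof (cases "v = 0")
      case True
      then show ?thesis using T_skew[of v "T v"] v TD DV by simp
    next
      case False
      have pos_v: "h v v > 0" using pos[of v] False v DV by blast
      have nn: "h (T v) (T v) \<ge> 0" using self_nonneg v TD DV by blast
      have "cos t = cos (arccos (sqrt (h (T v) (T v)) / sqrt (h v v)))"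
        using t[OF v False] angle[OF v] by simp
      also have "\<dots> = sqrt (h (T v) (T v)) / sqrt (h v v)"
        using pos_v nn T_le[OF v]
        by (intro cos_arccos) (auto intro: order_trans[of "-1" 0])
      finally show ?thesis
        using pos_v nn by (simp add: power_divide)
    qed
    have "T (T v) = - ((cos t)\<^sup>2 *\<^sub>R v)" if v: "v \<in> D" for v
    proof -
      \<comment> \<open>The defect of the claim. Moving one \<open>T\<close> across turns
        \<open>h q q\<close> into \<open>(cos t)\<^sup>2 * h v q - h (T v) (T q)\<close>.\<close>
      define q where "q = T (T v) + (cos t)\<^sup>2 *\<^sub>R v"
      have q: "q \<in> D"
        unfolding q_def using v TD D(1) by (intro subspace_add subspace_scale) auto
      have s: "v \<in> V" "q \<in> V" "T v \<in> V" "T q \<in> V" "T (T v) \<in> V" "v + q \<in> D"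
        using v q TD DV D(1) subspace_add by blast+
      \<comment> \<open>Polarization: compare \<open>norm_T\<close> at \<open>v + q\<close> with
        \<open>norm_T\<close> at \<open>v\<close> and at \<open>q\<close>.\<close>
      have "h (T v) (T q) = (cos t)\<^sup>2 * h v q"
        using norm_T[OF v] norm_T[OF q] norm_T[OF s(6)] s
        by (simp add: T_add v q add_left add_right sym[of q v] sym[of "T q" "T v"] algebra_simps)
      then have "h q q = 0"
        using s T_skew[of "T v" q] v q TD
        by (subst (1) q_def) (simp add: add_left scale_left)
      then show ?thesis
        using self_eq_0_iff[of q] s by (simp add: q_def eq_neg_iff_add_eq_0)
    qed
    then show "\<exists>t. \<forall>v\<in>D. T (T v) = - ((cos t)\<^sup>2 *\<^sub>R v)" by blast
  next
    assume "\<exists>t. \<forall>v\<in>D. T (T v) = - ((cos t)\<^sup>2 *\<^sub>R v)"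
    then obtain t where t: "\<And>v. v \<in> D \<Longrightarrow> T (T v) = - ((cos t)\<^sup>2 *\<^sub>R v)"
      by blast
    \<comment> \<open>Only the square of \<open>cos t\<close> is given, and the angle lies in
      [0, \<pi>/2]; hence the absolute value, and the constant angle need not be
      \<open>t\<close>.\<close>
    have "angle_to_subspace h D (J v) = arccos \<bar>cos t\<bar>" if v: "v \<in> D" "v \<noteq> 0" for v
    proof -
      have "h (T v) (T v) = (cos t)\<^sup>2 * h v v"
        using T_skew[of v "T v"] t[of v] v TD DV by (simp add: minus_right scale_right)
      then show ?thesis
        using angle[OF v(1)] pos[of v] v DV by (simp add: real_sqrt_mult)
    qed
    then show "\<exists>t. \<forall>v\<in>D. v \<noteq> 0 \<longrightarrow> angle_to_subspace h D (J v) = t" by blast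
  qed
qed

end

section \<open>Tangent spaces of manifolds and submanifolds\<close>

lemma smooth_on_linear_frechet_derivative:
  assumes "smooth_on S f" "x \<in> S"
  shows "linear (frechet_derivative f (at x))"
proof -
  have "Ck_on (Suc 0) S f" using assms by (simp add: smooth_on_def)
  then show ?thesis using assms by (simp add: linear_frechet_derivative)
qed

context smooth_manifold
begin

lemma linear_frechet_derivative_transition:
  assumes "c \<in> charts_at A p" "d \<in> charts_at A p"
  shows "linear (frechet_derivative (transition c d) (at (snd c p)))"
  using assms compatible[of c d]
  by (intro smooth_on_linear_frechet_derivative[where S = "snd c ` (fst c \<inter> fst d)"])
    (auto simp: charts_at_def)

lemma tangent_spaceD:
  assumes "v \<in> tangent_space A p" "c \<in> charts_at A p" "d \<in> charts_at A p"
  shows "v d = frechet_derivative (transition c d) (at (snd c p)) (v c)"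
  using assms unfolding tangent_space_def by blast

lemma tangent_space_outside: "v \<in> tangent_space A p \<Longrightarrow> c \<notin> charts_at A p \<Longrightarrow> v c = 0"
  unfolding tangent_space_def by blast

lemma subspace_tangent_space: "subspace (tangent_space A p)"
  unfolding subspace_def
proof (intro conjI ballI allI)
  note lin = linear_frechet_derivative_transition[of _ p]
  show "0 \<in> tangent_space A p"
    using lin by (simp add: tangent_space_def linear_0)
  show "u + v \<in> tangent_space A p" if "u \<in> tangent_space A p" "v \<in> tangent_space A p" for u v
  proof -
    have "(u + v) d = frechet_derivative (transition c d) (at (snd c p)) ((u + v) c)"
      if "c \<in> charts_at A p" "d \<in> charts_at A p" for c d
      using tangent_spaceD[OF \<open>u \<in> _\<close> that] tangent_spaceD[OF \<open>v \<in> _\<close> that] lin[OF that]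
      by (simp add: linear_add)
    moreover have "(u + v) c = 0" if "c \<notin> charts_at A p" for c
      using tangent_space_outside[OF \<open>u \<in> _\<close> that] tangent_space_outside[OF \<open>v \<in> _\<close> that] by simp
    ultimately show ?thesis unfolding tangent_space_def by blast
  qed
  show "r *\<^sub>R v \<in> tangent_space A p" if "v \<in> tangent_space A p" for r v
  proof -
    have "(r *\<^sub>R v) d = frechet_derivative (transition c d) (at (snd c p)) ((r *\<^sub>R v) c)"
      if "c \<in> charts_at A p" "d \<in> charts_at A p" for c d
      using tangent_spaceD[OF \<open>v \<in> _\<close> that] lin[OF that]
      by (simp add: scaleR_fun_def linear_cmul)
    moreover have "(r *\<^sub>R v) c = 0" if "c \<notin> charts_at A p" for c
      using tangent_space_outside[OF \<open>v \<in> _\<close> that] by (simp add: scaleR_fun_def)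
    ultimately show ?thesis unfolding tangent_space_def by blast
  qed
qed

text \<open>All other components are transition derivatives of this one or 0. One chart thus embeds
  the tangent space in the Euclidean model.\<close>

lemma inj_on_tangent_component:
  assumes "c \<in> charts_at A p"
  shows "inj_on (\<lambda>v. v c) (tangent_space A p)"
proof (rule inj_onI)
  fix u v assume uv: "u \<in> tangent_space A p" "v \<in> tangent_space A p" "u c = v c"
  have "u d = v d" for d
  proof (cases "d \<in> charts_at A p")
    case True
    then show ?thesis
      using tangent_spaceD[OF uv(1) assms True] tangent_spaceD[OF uv(2) assms True] uv(3) by argo
  next
    case False
    then show ?thesis
      using tangent_space_outside[OF uv(1)] tangent_space_outside[OF uv(2)] by simp
  qed
  then show "u = v" by blast
qed

text \<open>Supplies the finite generating set for Gram-Schmidt: a basis of \<open>W\<close> maps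
  injectively to an independent, hence finite, set in the model space.\<close>

lemma tangent_subspace_eq_span:
  assumes p: "p \<in> topspace X" and W: "subspace W" "W \<subseteq> tangent_space A p"
  obtains S where "finite S" "span S = W"
proof -
  obtain c where c: "c \<in> charts_at A p"
    using p unfolding covers[symmetric] charts_at_def by blast
  obtain S where S: "S \<subseteq> W" "independent S" "W \<subseteq> span S"
    using maximal_independent_subset[of W] by blast
  have span: "span S = W"
    using S W span_minimal by blast
  have lin: "linear (\<lambda>v :: ('a, 'e) tvec. v c)"
    by (rule linearI) (simp_all add: scaleR_fun_def)
  have inj: "inj_on (\<lambda>v. v c) (span S)"
    using inj_on_tangent_component[OF c] W span inj_on_subset by blast
  have "independent ((\<lambda>v. v c) ` S)"
    using linear_independent_injective_image[OF lin S(2) inj] .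
  then have "finite ((\<lambda>v. v c) ` S)"
    by (rule independent_imp_finite)
  then have "finite S"
    using inj_on_subset[OF inj span_superset] by (rule finite_imageD)
  then show thesis using span by (rule that)
qed

end

lemma (in submanifold) subspace_sub_tangent_space: "subspace (sub_tangent_space B A p)"
proof -
  \<comment> \<open>Linearity of the differential of the inclusion lets the witnesses in the tangent
    space of \<open>B\<close> add and scale along.\<close>
  have lin: "linear (frechet_derivative (transition b c) (at (snd b p)))"
    if "b \<in> charts_at B p" "c \<in> charts_at A p" for b c
    using that inclusion_smooth[of b c]
    by (intro smooth_on_linear_frechet_derivative[where S = "snd b ` (fst b \<inter> fst c)"])
      (auto simp: charts_at_def)
  note M = M.subspace_tangent_space[of p] and N = N.subspace_tangent_space[of p]
  show ?thesis
    unfolding subspace_def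
  proof (intro conjI ballI allI)
    show "0 \<in> sub_tangent_space B A p"
      using subspace_0[OF M] subspace_0[OF N] lin
      by (auto simp: sub_tangent_space_def linear_0 intro!: bexI[of _ 0])
  next
    fix u v assume "u \<in> sub_tangent_space B A p" "v \<in> sub_tangent_space B A p"
    then obtain u' v' where
      "u \<in> tangent_space A p" "u' \<in> tangent_space B p"
      "\<forall>b\<in>charts_at B p. \<forall>c\<in>charts_at A p.
        u c = frechet_derivative (transition b c) (at (snd b p)) (u' b)"
      "v \<in> tangent_space A p" "v' \<in> tangent_space B p"
      "\<forall>b\<in>charts_at B p. \<forall>c\<in>charts_at A p.
        v c = frechet_derivative (transition b c) (at (snd b p)) (v' b)"
      unfolding sub_tangent_space_def by blast
    then show "u + v \<in> sub_tangent_space B A p"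
      using subspace_add[OF M] subspace_add[OF N] lin
      by (auto simp: sub_tangent_space_def linear_add intro!: bexI[of _ "u' + v'"])
  next
    fix r v assume "v \<in> sub_tangent_space B A p"
    then obtain v' where
      "v \<in> tangent_space A p" "v' \<in> tangent_space B p"
      "\<forall>b\<in>charts_at B p. \<forall>c\<in>charts_at A p.
        v c = frechet_derivative (transition b c) (at (snd b p)) (v' b)"
      unfolding sub_tangent_space_def by blast
    then show "r *\<^sub>R v \<in> sub_tangent_space B A p"
      using subspace_scale[OF M] subspace_scale[OF N] lin
      by (auto simp: sub_tangent_space_def scaleR_fun_def linear_cmul intro!: bexI[of _ "r *\<^sub>R v'"])
  qed
qed

section \<open>Almost contact metric structures\<close>

context almost_contact_metric_manifold
begin

lemma inner_product_on_tangent_space: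
  assumes "p \<in> topspace X"
  shows "inner_product_on (tangent_space A p) (g p)"
  using assms metric subspace_tangent_space
  by unfold_locales (auto simp: riemannian_metric_def)

lemma linear_phi: "p \<in> topspace X \<Longrightarrow> linear_between (tangent_space A p) (tangent_space A p) (\<phi> p)"
  using phi_tensor by (simp add: smooth_tensor_1_1_def)

lemma phi_tangent: "p \<in> topspace X \<Longrightarrow> u \<in> tangent_space A p \<Longrightarrow> \<phi> p u \<in> tangent_space A p"
  using linear_phi[of p] by (auto simp: linear_between_def)

lemma phi_scale:
  "p \<in> topspace X \<Longrightarrow> u \<in> tangent_space A p \<Longrightarrow> \<phi> p (r *\<^sub>R u) = r *\<^sub>R \<phi> p u"
  using linear_phi[of p] by (auto simp: linear_between_def)

lemma xi_tangent: "p \<in> topspace X \<Longrightarrow> \<xi> p \<in> tangent_space A p"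
  using xi_field by (simp add: smooth_vector_field_def)

text \<open>For \<open>u\<close> = \<phi>\<xi>, first \<phi>u = 0, so the formula for \<phi>\<phi>u
  gives u = \<eta>(u)\<xi>. Applying \<phi> once more yields \<eta>(u)u = 0, and either factor being
  zero forces u = 0.\<close>

lemma phi_xi:
  assumes p: "p \<in> topspace X"
  shows "\<phi> p (\<xi> p) = 0"
proof -
  note x = xi_tangent[OF p]
  let ?u = "\<phi> p (\<xi> p)"
  have 0: "\<phi> p ?u = 0"
    using phi_phi[OF p x] eta_xi[OF p] by simp
  have "\<phi> p (\<phi> p ?u) = 0"
    using phi_scale[OF p x, of 0] 0 by simp
  then have u: "?u = \<eta> p ?u *\<^sub>R \<xi> p"
    using phi_phi[OF p phi_tangent[OF p x]] by simp
  then have "\<eta> p ?u *\<^sub>R ?u = 0"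
    using phi_scale[OF p x, of "\<eta> p ?u"] 0 by simp
  then show ?thesis
    using u by (metis scaleR_eq_0_iff)
qed

text \<open>Take \<xi> as second argument in \<open>metric_phi\<close>; the left side vanishes by
  \<open>phi_xi\<close>.\<close>

lemma metric_xi:
  assumes p: "p \<in> topspace X" and u: "u \<in> tangent_space A p"
  shows "g p u (\<xi> p) = \<eta> p u"
proof -
  interpret inner_product_on "tangent_space A p" "g p"
    by (rule inner_product_on_tangent_space[OF p])
  show ?thesis
    using metric_phi[OF p u xi_tangent[OF p]] phi_tangent[OF p u] phi_xi[OF p] eta_xi[OF p]
    by simp
qed

text \<open>On the kernel of \<eta>, \<phi> squares to -1; insert \<phi>v as second argument in
  \<open>metric_phi\<close>.\<close>

lemma phi_skew:
  assumes p: "p \<in> topspace X" and u: "u \<in> tangent_space A p" "\<eta> p u = 0"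
    and v: "v \<in> tangent_space A p" "\<eta> p v = 0"
  shows "g p (\<phi> p u) v = - g p u (\<phi> p v)"
proof -
  interpret inner_product_on "tangent_space A p" "g p"
    by (rule inner_product_on_tangent_space[OF p])
  show ?thesis
    using metric_phi[OF p u(1) phi_tangent[OF p v(1)]] phi_phi[OF p v(1)] u v phi_tangent[OF p]
    by (simp add: minus_right)
qed

end

section \<open>Reduction to a single tangent space\<close>

text \<open>\<open>T_acts\<close> makes explicit that \<open>T\<close> is an endomorphism of each
  \<open>M\<^sub>p\<close>, as reading the square of \<open>T\<close> on these spaces presupposes.
  It holds, for instance, when \<xi> is everywhere tangent or everywhere normal to the
  submanifold.\<close>

theorem lemma4p4:
  fixes X Y :: "'a topology"
    and A :: "('a, 'e::euclidean_space) chart set"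
    and B :: "('a, 'f::euclidean_space) chart set"
    and \<phi> :: "'a \<Rightarrow> ('a, 'e) tvec \<Rightarrow> ('a, 'e) tvec"
    and \<xi> :: "'a \<Rightarrow> ('a, 'e) tvec"
    and \<eta> :: "'a \<Rightarrow> ('a, 'e) tvec \<Rightarrow> real"
    and g :: "'a \<Rightarrow> ('a, 'e) tvec \<Rightarrow> ('a, 'e) tvec \<Rightarrow> real"
    and n :: nat
  defines "T \<equiv> tangential_part B A \<phi> g"
  assumes N: "almost_contact_metric_manifold X A n \<phi> \<xi> \<eta> g"
    and M: "submanifold Y B X A"
    and T_acts: "\<forall>p\<in>topspace Y. \<forall>v\<in>xi_orth_space B A \<xi> g p. T p v \<in> xi_orth_space B A \<xi> g p"
  shows "pointwise_slant Y B A \<phi> \<xi> g \<longleftrightarrow>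
    (\<exists>\<theta> :: 'a \<Rightarrow> real. \<forall>p\<in>topspace Y. \<forall>v\<in>xi_orth_space B A \<xi> g p.
       T p (T p v) = - ((cos (\<theta> p))\<^sup>2 *\<^sub>R v))"
proof -
  interpret N: almost_contact_metric_manifold X A n \<phi> \<xi> \<eta> g by (rule N)
  interpret M: submanifold Y B X A by (rule M)
  let ?D = "xi_orth_space B A \<xi> g"
  have "(\<exists>t. \<forall>v\<in>?D p. v \<noteq> 0 \<longrightarrow> angle_to_subspace (g p) (?D p) (\<phi> p v) = t) \<longleftrightarrow>
    (\<exists>t. \<forall>v\<in>?D p. T p (T p v) = - ((cos t)\<^sup>2 *\<^sub>R v))" if pY: "p \<in> topspace Y" for p
  proof -
    have p: "p \<in> topspace X" using pY M.subset by blast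
    interpret inner_product_on "tangent_space A p" "g p"
      by (rule N.inner_product_on_tangent_space[OF p])
    have W: "subspace (sub_tangent_space B A p)" "sub_tangent_space B A p \<subseteq> tangent_space A p"
      using M.subspace_sub_tangent_space by (auto simp: sub_tangent_space_def)
    have DV: "v \<in> tangent_space A p" if "v \<in> ?D p" for v
      using that W by (auto simp: xi_orth_space_def)
    \<comment> \<open>Orthogonality to \<xi> becomes vanishing of \<eta>, which removes the
      correction terms from \<open>metric_phi\<close> and \<open>phi_phi\<close>.\<close>
    have \<eta>0: "\<eta> p v = 0" if "v \<in> ?D p" for v
      using that N.metric_xi[OF p DV[OF that]] by (simp add: xi_orth_space_def)
    obtain S where S: "finite S" "span S = sub_tangent_space B A p"
      using N.tangent_subspace_eq_span[OF p W] .
    have subspace_D: "subspace (?D p)"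
      using subspace_0[OF W(1)] subspace_add[OF W(1)] subspace_scale[OF W(1)] W(2)
        N.xi_tangent[OF p]
      by (simp add: subspace_def xi_orth_space_def add_left scale_left subset_iff)
    have D_sub: "?D p \<subseteq> sub_tangent_space B A p"
      by (auto simp: xi_orth_space_def)
    have ex_proj: "\<exists>w\<in>sub_tangent_space B A p. \<forall>z\<in>sub_tangent_space B A p. g p (v - w) z = 0"
      if "v \<in> tangent_space A p" for v
      using orthogonal_decomposition_span[OF S(1) _ that] span_superset[of S] W(2)
      unfolding S(2) by blast
    have iso: "g p (\<phi> p v) (\<phi> p v) = g p v v" if "v \<in> ?D p" for v
      using N.metric_phi[OF p DV[OF that] DV[OF that]] \<eta>0[OF that] by simp
    have skew: "g p (\<phi> p u) v = - g p u (\<phi> p v)" if "u \<in> ?D p" "v \<in> ?D p" for u v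
      using that N.phi_skew[OF p] DV \<eta>0 by blast
    have T: "T p v = orth_proj (g p) (sub_tangent_space B A p) (\<phi> p v)" for v
      by (simp only: T_def tangential_part_def)
    have TD: "T p v \<in> ?D p" if "v \<in> ?D p" for v
      using T_acts pY that by blast
    show ?thesis
      by (rule compression_slant_iff[where J = "\<phi> p" and T = "T p",
            OF subspace_D D_sub W ex_proj N.linear_phi[OF p] iso skew T TD])
  qed
  then have "pointwise_slant Y B A \<phi> \<xi> g \<longleftrightarrow>
    (\<forall>p\<in>topspace Y. \<exists>t. \<forall>v\<in>?D p. T p (T p v) = - ((cos t)\<^sup>2 *\<^sub>R v))"
    by (simp add: pointwise_slant_def)
  \<comment> \<open>The constants at the single points are collected into one function \<theta> by
    choice.\<close>
  then show ?thesis
    by (simp add: bchoice_iff)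
qed

end
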